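(* Suppose $\alpha\le\frac{2\delta}{\mu}<\beta$ and $M_0\left(\frac{2\delta}{\mu}\right)<M\le M_\beta$. Then the function $$V(x)=\begin{cases}\dfrac{\mu a(x)-2\delta}{2\gamma}\left(\dfrac{a(x)-c}{\tilde c-c}\right)^{-\Gamma}, & 0\le x<x_1,\\[1mm] \dfrac{M}{\gamma}-\dfrac{\sigma^2\tilde c}{\mu}\exp\left(-\dfrac{\mu}{\sigma^2\tilde c}(x-x_1)\right), & x\ge x_1,\end{cases}$$ (with all quantities as defined in the context) is a concave, twice continuously differentiable solution on $[0,\infty)$ of the HJB equation $$0=\max_{\alpha\le a\le\beta}\left(\tfrac12\sigma^2a^2V''(x)+(a\mu-\delta)V'(x)-\gamma V(x)+M(1-V'(x))^+\right),\qquad V(0)=0,$$ and it satisfies $0\le V(x)\le\frac{M}{\gamma}$ for all $x>0$.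
   Context: Parameters: real constants $\mu>0$, $\sigma>0$, $\gamma>0$, $\delta\ge0$, $M>0$, $0<\alpha<\beta<\infty$; $y^+=\max(y,0)$. $c=\dfrac{2\delta\mu}{\mu^2+2\gamma\sigma^2}$, $\tilde c=\dfrac{2\mu(\delta+M)}{\mu^2+2\gamma\sigma^2}$, $\Gamma=\dfrac{\mu^2}{\mu^2+2\gamma\sigma^2}$, $M_\beta=(\beta-c)\dfrac{\mu^2+2\gamma\sigma^2}{2\mu}$. $M_0(z)=\dfrac{z^2\sigma^2\gamma}{2(z\mu-\delta)}$ for $z>\delta/\mu$, so $M_0\left(\frac{2\delta}{\mu}\right)=\dfrac{2\delta\sigma^2\gamma}{\mu^2}$. $G(u)=u+c\log(u-c)$ for $u>c$, with $G^{-1}$ its inverse, and $a(x)=G^{-1}\left(\dfrac{\mu^2+2\gamma\sigma^2}{\mu\sigma^2}x+G\left(\dfrac{2\delta}{\mu}\right)\right)$ for $x\ge0$. $x_1=\dfrac{\mu\sigma^2}{\mu^2+2\gamma\sigma^2}\displaystyle\int_{2\delta/\mu}^{\tilde c}\frac{u\,du}{u-c}$ (equivalently, $a(x_1)=\tilde c$). *)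

theory Defs
  imports "HOL-Analysis.Analysis"
begin

definition c_low :: "real \<Rightarrow> real \<Rightarrow> real \<Rightarrow> real \<Rightarrow> real" where
  "c_low \<mu> \<sigma> \<gamma> \<delta> = 2 * \<delta> * \<mu> / (\<mu>\<^sup>2 + 2 * \<gamma> * \<sigma>\<^sup>2)"

definition c_tilde :: "real \<Rightarrow> real \<Rightarrow> real \<Rightarrow> real \<Rightarrow> real \<Rightarrow> real" where
  "c_tilde \<mu> \<sigma> \<gamma> \<delta> M = 2 * \<mu> * (\<delta> + M) / (\<mu>\<^sup>2 + 2 * \<gamma> * \<sigma>\<^sup>2)"

definition Gam :: "real \<Rightarrow> real \<Rightarrow> real \<Rightarrow> real" where
  "Gam \<mu> \<sigma> \<gamma> = \<mu>\<^sup>2 / (\<mu>\<^sup>2 + 2 * \<gamma> * \<sigma>\<^sup>2)"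

definition M_beta :: "real \<Rightarrow> real \<Rightarrow> real \<Rightarrow> real \<Rightarrow> real \<Rightarrow> real" where
  "M_beta \<mu> \<sigma> \<gamma> \<delta> \<beta> =
     (\<beta> - c_low \<mu> \<sigma> \<gamma> \<delta>) * ((\<mu>\<^sup>2 + 2 * \<gamma> * \<sigma>\<^sup>2) / (2 * \<mu>))"

text \<open>Meaningful for \<open>z > \<delta> / \<mu>\<close> only.\<close>
definition M_zero :: "real \<Rightarrow> real \<Rightarrow> real \<Rightarrow> real \<Rightarrow> real \<Rightarrow> real" where
  "M_zero \<mu> \<sigma> \<gamma> \<delta> z = z\<^sup>2 * \<sigma>\<^sup>2 * \<gamma> / (2 * (z * \<mu> - \<delta>))"

text \<open>The domain of \<open>G\<close> is the open half line above \<open>c_low\<close>; its inverse is taken on that domain.\<close>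
definition G_fun :: "real \<Rightarrow> real \<Rightarrow> real \<Rightarrow> real \<Rightarrow> real \<Rightarrow> real" where
  "G_fun \<mu> \<sigma> \<gamma> \<delta> u = u + c_low \<mu> \<sigma> \<gamma> \<delta> * ln (u - c_low \<mu> \<sigma> \<gamma> \<delta>)"

definition G_inv :: "real \<Rightarrow> real \<Rightarrow> real \<Rightarrow> real \<Rightarrow> real \<Rightarrow> real" where
  "G_inv \<mu> \<sigma> \<gamma> \<delta> = the_inv_into {c_low \<mu> \<sigma> \<gamma> \<delta> <..} (G_fun \<mu> \<sigma> \<gamma> \<delta>)"

definition a_fun :: "real \<Rightarrow> real \<Rightarrow> real \<Rightarrow> real \<Rightarrow> real \<Rightarrow> real" where
  "a_fun \<mu> \<sigma> \<gamma> \<delta> x =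
     G_inv \<mu> \<sigma> \<gamma> \<delta>
       ((\<mu>\<^sup>2 + 2 * \<gamma> * \<sigma>\<^sup>2) / (\<mu> * \<sigma>\<^sup>2) * x + G_fun \<mu> \<sigma> \<gamma> \<delta> (2 * \<delta> / \<mu>))"

text \<open>The integral over a set is unoriented; it is the intended one when
  \<open>2 * \<delta> / \<mu> \<le> c_tilde \<mu> \<sigma> \<gamma> \<delta> M\<close>, equivalently \<open>M_zero \<mu> \<sigma> \<gamma> \<delta> (2 * \<delta> / \<mu>) \<le> M\<close>
  (for \<open>\<delta> > 0\<close>).\<close>
definition x_one :: "real \<Rightarrow> real \<Rightarrow> real \<Rightarrow> real \<Rightarrow> real \<Rightarrow> real" where
  "x_one \<mu> \<sigma> \<gamma> \<delta> M =
     \<mu> * \<sigma>\<^sup>2 / (\<mu>\<^sup>2 + 2 * \<gamma> * \<sigma>\<^sup>2) *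
       integral {2 * \<delta> / \<mu> .. c_tilde \<mu> \<sigma> \<gamma> \<delta> M} (\<lambda>u. u / (u - c_low \<mu> \<sigma> \<gamma> \<delta>))"

definition V_fun :: "real \<Rightarrow> real \<Rightarrow> real \<Rightarrow> real \<Rightarrow> real \<Rightarrow> real \<Rightarrow> real" where
  "V_fun \<mu> \<sigma> \<gamma> \<delta> M x =
     (if x < x_one \<mu> \<sigma> \<gamma> \<delta> M
      then (\<mu> * a_fun \<mu> \<sigma> \<gamma> \<delta> x - 2 * \<delta>) / (2 * \<gamma>) *
           ((a_fun \<mu> \<sigma> \<gamma> \<delta> x - c_low \<mu> \<sigma> \<gamma> \<delta>)
             / (c_tilde \<mu> \<sigma> \<gamma> \<delta> M - c_low \<mu> \<sigma> \<gamma> \<delta>)) powr (- Gam \<mu> \<sigma> \<gamma>)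
      else M / \<gamma> - \<sigma>\<^sup>2 * c_tilde \<mu> \<sigma> \<gamma> \<delta> M / \<mu> *
           exp (- (\<mu> / (\<sigma>\<^sup>2 * c_tilde \<mu> \<sigma> \<gamma> \<delta> M)) * (x - x_one \<mu> \<sigma> \<gamma> \<delta> M)))"

definition is_maximum_on :: "('a \<Rightarrow> real) \<Rightarrow> 'a set \<Rightarrow> real \<Rightarrow> bool" where
  "is_maximum_on f S m \<longleftrightarrow> (\<exists>a\<in>S. f a = m) \<and> (\<forall>a\<in>S. f a \<le> m)"

text \<open>Derivatives are taken within \<open>S\<close>, so they are one-sided at the endpoint \<open>0\<close> of \<open>{0..}\<close>.\<close>
definition C2_derivs_on ::
    "real set \<Rightarrow> (real \<Rightarrow> real) \<Rightarrow> (real \<Rightarrow> real) \<Rightarrow> (real \<Rightarrow> real) \<Rightarrow> bool" where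
  "C2_derivs_on S v v' v'' \<longleftrightarrow>
     (\<forall>x\<in>S. (v has_real_derivative v' x) (at x within S)) \<and>
     (\<forall>x\<in>S. (v' has_real_derivative v'' x) (at x within S)) \<and>
     continuous_on S v''"

end

theory Submission
  imports Defs
begin

text \<open>
  The candidate is built so that, on both branches, its first two derivatives are tied to a single
  function \<open>b > 0\<close>, the optimal control: \<open>b x = a x\<close> below the switching point \<open>x\<^sub>1\<close> and
  \<open>b x = c\<^sub>t\<close> from there on, where
  \<open>c\<^sub>t\<close> is the constant \<open>c_tilde\<close>. On both branches
  \<open>V'' = - \<mu> / (\<sigma>\<^sup>2 b) V'\<close>, and the running payoff \<open>M (1 - V')\<^sup>+ - \<gamma> V\<close> equals
  \<open>(\<delta> - \<mu> b / 2) V'\<close>. Substituting these two relations turns the HJB expression at a control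
  \<open>s\<close> into the square \<open>- \<mu> V' / (2 b) (s - b)\<^sup>2\<close>. Its maximum over \<open>[\<alpha>, \<beta>]\<close> is therefore \<open>0\<close>
  as soon as \<open>V' > 0\<close> and \<open>\<alpha> \<le> b x \<le> \<beta>\<close>.

  The function \<open>a\<close> solves \<open>a' = k (a - c) / a\<close>, \<open>k = (\<mu>\<^sup>2 + 2 \<gamma> \<sigma>\<^sup>2) / (\<mu> \<sigma>\<^sup>2)\<close>, with
  \<open>a 0 = 2 \<delta> / \<mu>\<close>, because \<open>G' u = u / (u - c)\<close>;
  this differential equation is exactly what makes the derivative of the lower branch collapse to
  the power \<open>((a - c) / (c\<^sub>t - c)) powr (- \<Gamma>)\<close>. Since \<open>a\<close> increases from \<open>2 \<delta> / \<mu>\<close> to \<open>c\<^sub>t\<close> on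
  \<open>[0, x\<^sub>1]\<close>, that power decreases to \<open>1\<close>, so \<open>V' \<ge> 1\<close> below \<open>x\<^sub>1\<close> and \<open>V' \<le> 1\<close> above, which
  decides the positive part. The two bounds on \<open>M\<close> say \<open>2 \<delta> / \<mu> < c\<^sub>t\<close> and \<open>c\<^sub>t \<le> \<beta>\<close>, which
  gives \<open>x\<^sub>1 > 0\<close> and, with \<open>\<alpha> \<le> 2 \<delta> / \<mu>\<close>, keeps \<open>b\<close> inside \<open>[\<alpha>, \<beta>]\<close>.

  Both branches are smooth on the whole real line (\<open>0 < \<alpha> \<le> 2 \<delta> / \<mu>\<close> forces
  \<open>\<delta> > 0\<close>, hence \<open>c > 0\<close>, and then \<open>G\<close> maps onto the line, so \<open>a\<close> is defined everywhere), and they agree at \<open>x\<^sub>1\<close> together with their first two derivatives; gluing gives a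
  twice continuously differentiable function. Concavity and the bounds on \<open>V\<close> follow from
  \<open>V'' \<le> 0 < V'\<close>.
\<close>

section \<open>Gluing two functions at a point\<close>

lemma DERIV_glue:
  fixes f g :: "real \<Rightarrow> real"
  assumes f: "\<And>x. (f has_real_derivative f' x) (at x)"
    and g: "\<And>x. (g has_real_derivative g' x) (at x)"
    and eq: "f p = g p" "f' p = g' p"
  shows "((\<lambda>x. if x < p then f x else g x) has_real_derivative (if x < p then f' x else g' x)) (at x)"
proof -
  have "((\<lambda>x. if x \<in> {..p} then f x else g x) has_derivative
           (if x \<in> {..p} then (*) (f' x) else (*) (g' x))) (at x within {..p} \<union> {p..})"
    by (rule has_derivative_If_within_closures)
      (use f g eq in \<open>auto simp: has_field_derivative_def intro: has_derivative_at_withinI\<close>)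
  moreover have "(\<lambda>x. if x \<in> {..p} then f x else g x) = (\<lambda>x. if x < p then f x else g x)"
    using eq by (auto simp: fun_eq_iff)
  moreover have "{..p} \<union> {p..} = UNIV" by auto
  moreover have "(if x \<in> {..p} then (*) (f' x) else (*) (g' x)) = (*) (if x < p then f' x else g' x)"
    using eq by (cases "x = p") (auto simp: fun_eq_iff)
  ultimately show ?thesis by (simp add: has_field_derivative_def)
qed

lemma continuous_on_glue:
  fixes f g :: "real \<Rightarrow> real"
  assumes "continuous_on UNIV f" "continuous_on UNIV g" "f p = g p"
  shows "continuous_on UNIV (\<lambda>x. if x < p then f x else g x)"
proof -
  have "continuous_on ({..p} \<union> {p..}) (\<lambda>x. if x \<le> p then f x else g x)"
    using assms by (intro continuous_on_cases) (auto intro: continuous_on_subset)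
  moreover have "{..p} \<union> {p..} = UNIV" by auto
  moreover have "(\<lambda>x. if x \<le> p then f x else g x) = (\<lambda>x. if x < p then f x else g x)"
    using assms(3) by (auto simp: fun_eq_iff)
  ultimately show ?thesis by metis
qed

section \<open>The constants\<close>

locale dividend_problem =
  fixes \<mu> \<sigma> \<gamma> \<delta> M :: real
  assumes mu: "\<mu> > 0" and sigma: "\<sigma> > 0" and gamma: "\<gamma> > 0" and delta: "\<delta> > 0"
    and M_large: "M_zero \<mu> \<sigma> \<gamma> \<delta> (2 * \<delta> / \<mu>) < M"
begin

abbreviation D where "D \<equiv> \<mu>\<^sup>2 + 2 * \<gamma> * \<sigma>\<^sup>2"
abbreviation c where "c \<equiv> c_low \<mu> \<sigma> \<gamma> \<delta>"
abbreviation ct where "ct \<equiv> c_tilde \<mu> \<sigma> \<gamma> \<delta> M"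
abbreviation \<Gamma> where "\<Gamma> \<equiv> Gam \<mu> \<sigma> \<gamma>"
abbreviation G where "G \<equiv> G_fun \<mu> \<sigma> \<gamma> \<delta>"
abbreviation a where "a \<equiv> a_fun \<mu> \<sigma> \<gamma> \<delta>"
abbreviation x1 where "x1 \<equiv> x_one \<mu> \<sigma> \<gamma> \<delta> M"
abbreviation V where "V \<equiv> V_fun \<mu> \<sigma> \<gamma> \<delta> M"
abbreviation k where "k \<equiv> D / (\<mu> * \<sigma>\<^sup>2)"

lemma D_pos: "D > 0"
  using mu sigma gamma by (simp add: add_pos_pos)

lemma k_pos: "k > 0"
  using D_pos mu sigma by simp

lemma c_pos: "c > 0"
  using D_pos mu delta by (simp add: c_low_def)

lemma Gam_pos: "\<Gamma> > 0"
  using D_pos mu by (simp add: Gam_def)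

lemma c_less_start: "c < 2 * \<delta> / \<mu>"
proof -
  have "\<delta> * \<mu>\<^sup>2 < \<delta> * D"
    using mu sigma gamma delta by simp
  then have "2 * \<delta> * \<mu> * \<mu> < 2 * \<delta> * D"
    by (simp add: power2_eq_square algebra_simps)
  then show ?thesis
    using D_pos mu by (simp add: c_low_def pos_divide_less_eq pos_less_divide_eq)
qed

lemma start_less_ct: "2 * \<delta> / \<mu> < ct"
proof -
  have "M_zero \<mu> \<sigma> \<gamma> \<delta> (2 * \<delta> / \<mu>) = 2 * \<delta> * \<sigma>\<^sup>2 * \<gamma> / \<mu>\<^sup>2"
    using mu delta by (simp add: M_zero_def field_simps power2_eq_square)
  then have "2 * \<delta> * \<sigma>\<^sup>2 * \<gamma> < M * \<mu>\<^sup>2"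
    using M_large mu by (simp add: pos_divide_less_eq)
  then have "\<delta> * D < (\<delta> + M) * \<mu>\<^sup>2"
    by (simp add: algebra_simps)
  then have "2 * \<delta> * D < 2 * \<mu> * (\<delta> + M) * \<mu>"
    by (simp add: power2_eq_square algebra_simps)
  then show ?thesis
    using D_pos mu by (simp add: c_tilde_def pos_divide_less_eq pos_less_divide_eq)
qed

lemma c_less_ct: "c < ct"
  using c_less_start start_less_ct by simp

lemma ct_pos: "ct > 0"
  using c_less_ct c_pos by simp

text \<open>This is the vanishing of the HJB expression at the control \<open>ct\<close> on the upper branch, and
  also the condition for the two branches to have the same value at \<open>x1\<close>.\<close>
lemma ct_equation: "\<mu> * ct / 2 - \<delta> = M - \<gamma> * \<sigma>\<^sup>2 * ct / \<mu>"
proof -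
  have "ct * D = 2 * \<mu> * (\<delta> + M)"
    using D_pos by (simp add: c_tilde_def)
  then show ?thesis
    using mu by (simp add: field_simps power2_eq_square)
qed

section \<open>The control below the switching point\<close>

lemma G_DERIV: "u > c \<Longrightarrow> (G has_real_derivative u / (u - c)) (at u)"
  unfolding G_fun_def
  by (auto intro!: derivative_eq_intros simp: field_simps)

lemma G_strict_mono: "strict_mono_on {c<..} G"
  using c_pos by (auto simp: strict_mono_on_def G_fun_def intro!: add_strict_mono)

text \<open>The term \<open>c * ln (u - c)\<close> takes \<open>G\<close> to \<open>-\<infinity>\<close> at \<open>c\<close>, which is where \<open>\<delta> > 0\<close> enters; both
  witnesses below come from solving the dominant part of \<open>G u = y\<close>.\<close>
lemma G_surj: "G ` {c<..} = UNIV"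
proof -
  have "\<exists>u>c. G u = y" for y
  proof -
    define t where "t = min 1 (exp ((y - c - 1) / c))"
    have t: "0 < t" "t \<le> 1" by (auto simp: t_def)
    have "ln t \<le> (y - c - 1) / c"
      using ln_mono[of t "exp ((y - c - 1) / c)"] t(1) by (simp add: t_def)
    then have "c * ln t \<le> y - c - 1"
      using c_pos by (simp add: field_simps)
    then have low: "G (c + t) \<le> y"
      using t by (simp add: G_fun_def)
    define w where "w = max (c + 1) y"
    have "0 \<le> c * ln (w - c)"
      using c_pos by (intro mult_nonneg_nonneg ln_ge_zero) (auto simp: w_def)
    then have high: "y \<le> G w"
      by (auto simp: G_fun_def w_def)
    have "c + t \<le> w" using t by (simp add: w_def)
    moreover have "\<forall>u. c + t \<le> u \<and> u \<le> w \<longrightarrow> isCont G u"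
      using t by (auto intro!: DERIV_isCont[OF G_DERIV])
    ultimately obtain u where "c + t \<le> u" "G u = y"
      using IVT[of G "c + t" y w] low high by auto
    then show ?thesis using t by (intro exI[of _ u]) auto
  qed
  then show ?thesis by (auto simp: image_iff) (metis greaterThan_iff)
qed

lemma G_inj: "inj_on G {c<..}"
  using G_strict_mono by (rule strict_mono_on_imp_inj_on)

lemma a_greater_c: "a x > c"
  using the_inv_into_into[OF G_inj, of _ "{c<..}"] G_surj
  by (auto simp: a_fun_def G_inv_def)

lemma G_a: "G (a x) = k * x + G (2 * \<delta> / \<mu>)"
  using f_the_inv_into_f[OF G_inj] G_surj by (auto simp: a_fun_def G_inv_def)

lemma a_eqI: "u > c \<Longrightarrow> G u = k * x + G (2 * \<delta> / \<mu>) \<Longrightarrow> a x = u"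
  using G_a[of x] a_greater_c[of x] inj_onD[OF G_inj] by fastforce

lemma a_pos: "a x > 0"
  using a_greater_c[of x] c_pos by simp

lemma a_zero: "a 0 = 2 * \<delta> / \<mu>"
  using c_less_start by (intro a_eqI) auto

lemma a_strict_mono: "strict_mono a"
proof (rule strict_monoI)
  fix x y :: real assume "x < y"
  then have "G (a x) < G (a y)"
    using mult_strict_left_mono[OF _ k_pos] unfolding G_a by fastforce
  then show "a x < a y"
    using strict_mono_on_less[OF G_strict_mono] a_greater_c by simp
qed

lemma a_DERIV: "(a has_real_derivative k * (a x - c) / a x) (at x)"
proof -
  let ?y = "k * x + G (2 * \<delta> / \<mu>)"
  have "(G_inv \<mu> \<sigma> \<gamma> \<delta> has_real_derivative inverse (a x / (a x - c))) (at (G (a x)))"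
  unfolding has_field_derivative_def
  proof (rule has_derivative_inverse_strong[of "{c<..}" "a x" G])
    show "(G has_derivative (*) (a x / (a x - c))) (at (a x))"
      using G_DERIV a_greater_c by (simp add: has_field_derivative_def)
    show "(*) (a x / (a x - c)) \<circ> (*) (inverse (a x / (a x - c))) = id"
      using a_pos[of x] a_greater_c[of x] by (auto simp: fun_eq_iff)
    show "continuous_on {c<..} G"
      using G_DERIV by (auto intro!: continuous_at_imp_continuous_on DERIV_isCont)
    show "G_inv \<mu> \<sigma> \<gamma> \<delta> (G z) = z" if "z \<in> {c<..}" for z
      using the_inv_into_f_f[OF G_inj that] by (simp add: G_inv_def)
  qed (use a_greater_c in auto)
  then have "(G_inv \<mu> \<sigma> \<gamma> \<delta> has_real_derivative (a x - c) / a x) (at ?y)"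
    by (simp add: G_a)
  moreover have "((\<lambda>x. k * x + G (2 * \<delta> / \<mu>)) has_real_derivative k) (at x)"
    using mu sigma by (auto intro!: derivative_eq_intros)
  ultimately have "((\<lambda>x. G_inv \<mu> \<sigma> \<gamma> \<delta> (k * x + G (2 * \<delta> / \<mu>)))
      has_real_derivative (a x - c) / a x * k) (at x)"
    by (rule DERIV_chain2)
  moreover have "(\<lambda>x. G_inv \<mu> \<sigma> \<gamma> \<delta> (k * x + G (2 * \<delta> / \<mu>))) = a"
    by (simp add: fun_eq_iff a_fun_def)
  ultimately show ?thesis by (simp add: mult_ac)
qed

text \<open>The integrand defining \<open>x1\<close> is \<open>G'\<close>.\<close>
lemma x1_eq: "k * x1 = G ct - G (2 * \<delta> / \<mu>)"
proof -
  have "((\<lambda>u. u / (u - c)) has_integral G ct - G (2 * \<delta> / \<mu>)) {2 * \<delta> / \<mu>..ct}"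
    using start_less_ct c_less_start G_DERIV
    by (intro fundamental_theorem_of_calculus)
      (auto simp: has_real_derivative_iff_has_vector_derivative[symmetric]
        intro: has_field_derivative_at_within)
  then show ?thesis
    using less_imp_neq[OF D_pos] mu sigma by (simp add: x_one_def integral_unique)
qed

lemma a_x1: "a x1 = ct"
  using c_less_ct x1_eq by (intro a_eqI) auto

lemma x1_pos: "x1 > 0"
  using strict_mono_less[OF a_strict_mono, of 0 x1] a_x1 a_zero start_less_ct by simp

section \<open>The two branches and their derivatives\<close>

definition slope_low :: "real \<Rightarrow> real" where
  "slope_low x = ((a x - c) / (ct - c)) powr (- \<Gamma>)"

definition slope_high :: "real \<Rightarrow> real" where
  "slope_high x = exp (- (\<mu> / (\<sigma>\<^sup>2 * ct)) * (x - x1))"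

definition slope :: "real \<Rightarrow> real" where
  "slope x = (if x < x1 then slope_low x else slope_high x)"

definition control :: "real \<Rightarrow> real" where
  "control x = (if x < x1 then a x else ct)"

definition curvature :: "real \<Rightarrow> real" where
  "curvature x = - \<mu> / (\<sigma>\<^sup>2 * control x) * slope x"

lemma slope_low_x1: "slope_low x1 = 1"
  using c_less_ct by (simp add: slope_low_def a_x1)

lemma slope_high_x1: "slope_high x1 = 1"
  by (simp add: slope_high_def)

lemma slope_pos: "slope x > 0"
  using a_greater_c[of x] c_less_ct by (simp add: slope_def slope_low_def slope_high_def)

lemma slope_ge_one:
  assumes "x < x1" shows "slope x \<ge> 1"
proof -
  have "a x < ct"
    using strict_mono_less[OF a_strict_mono, of x x1] assms a_x1 by simp
  then have "(a x - c) / (ct - c) \<le> 1" "(a x - c) / (ct - c) > 0"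
    using a_greater_c[of x] by auto
  then have "1 powr (- \<Gamma>) \<le> ((a x - c) / (ct - c)) powr (- \<Gamma>)"
    using Gam_pos by (intro powr_mono2') auto
  then show ?thesis using assms by (simp add: slope_def slope_low_def)
qed

lemma slope_le_one:
  assumes "x \<ge> x1" shows "slope x \<le> 1"
  using assms mu sigma ct_pos by (simp add: slope_def slope_high_def)

text \<open>The factor \<open>a - c\<close> cancels between the logarithmic derivative of the power and the equation
  for \<open>a'\<close>, leaving the coefficient \<open>\<Gamma> k = \<mu> / \<sigma>\<^sup>2\<close>.\<close>
lemma slope_low_DERIV:
  "(slope_low has_real_derivative - \<mu> / (\<sigma>\<^sup>2 * a x) * slope_low x) (at x)"
proof -
  let ?q = "(a x - c) / (ct - c)"
  have q: "?q > 0" using a_greater_c[of x] c_less_ct by simp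
  have "((\<lambda>x. (a x - c) / (ct - c)) has_real_derivative k * (a x - c) / a x / (ct - c)) (at x)"
    using c_less_ct by (auto intro!: derivative_eq_intros a_DERIV)
  from DERIV_fun_powr[OF this q, of "- \<Gamma>"]
  have "(slope_low has_real_derivative
      - \<Gamma> * ?q powr (- \<Gamma> - 1) * (k * (a x - c) / a x / (ct - c))) (at x)"
    by (simp add: slope_low_def[abs_def])
  moreover have "- \<Gamma> * ?q powr (- \<Gamma> - 1) * (k * (a x - c) / a x / (ct - c))
      = - (\<Gamma> * k) / a x * slope_low x"
  proof -
    have "?q powr (- \<Gamma> - 1) = slope_low x / ?q"
      using q by (simp only: powr_diff slope_low_def powr_one less_imp_le)
    then have "- \<Gamma> * ?q powr (- \<Gamma> - 1) * (k * (a x - c) / a x / (ct - c))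
        = - \<Gamma> * (slope_low x / ?q) * (k / a x * ?q)"
      by simp
    also have "\<dots> = - (\<Gamma> * k) / a x * slope_low x"
      using q by (auto simp: mult_ac)
    finally show ?thesis .
  qed
  moreover
  have "\<Gamma> * k = \<mu> / \<sigma>\<^sup>2"
    using D_pos mu by (simp add: Gam_def power2_eq_square)
  then have "- (\<Gamma> * k) / a x * slope_low x = - \<mu> / (\<sigma>\<^sup>2 * a x) * slope_low x"
    by simp
  ultimately show ?thesis by metis
qed

lemma slope_high_DERIV:
  "(slope_high has_real_derivative - \<mu> / (\<sigma>\<^sup>2 * ct) * slope_high x) (at x)"
  unfolding slope_high_def[abs_def] using sigma ct_pos by (auto intro!: derivative_eq_intros)

text \<open>The constant terms cancel because \<open>\<mu> c = 2 \<delta> \<Gamma>\<close>, and \<open>\<mu> (1 - \<Gamma>) = 2 \<gamma> / k\<close>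
  makes the remaining factor equal to one.\<close>
lemma V_low_DERIV:
  "((\<lambda>x. (\<mu> * a x - 2 * \<delta>) / (2 * \<gamma>) * slope_low x) has_real_derivative slope_low x) (at x)"
proof -
  have "((\<lambda>x. (\<mu> * a x - 2 * \<delta>) / (2 * \<gamma>)) has_real_derivative
      \<mu> * (k * (a x - c) / a x) / (2 * \<gamma>)) (at x)"
    using DERIV_cdivide[OF DERIV_diff[OF DERIV_cmult[OF a_DERIV] DERIV_const]]
    by (simp only: diff_0_right)
  from DERIV_mult[OF this slope_low_DERIV]
  have "((\<lambda>x. (\<mu> * a x - 2 * \<delta>) / (2 * \<gamma>) * slope_low x) has_real_derivative
      \<mu> * (k * (a x - c) / a x) / (2 * \<gamma>) * slope_low x
        + (\<mu> * a x - 2 * \<delta>) / (2 * \<gamma>) * (- \<mu> / (\<sigma>\<^sup>2 * a x) * slope_low x)) (at x)"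
    by (simp only: mult_ac)
  moreover have "\<mu> * (k * (a x - c) / a x) / (2 * \<gamma>) * slope_low x
        + (\<mu> * a x - 2 * \<delta>) / (2 * \<gamma>) * (- \<mu> / (\<sigma>\<^sup>2 * a x) * slope_low x) = slope_low x"
  proof -
    have "D * c = 2 * \<delta> * \<mu>" using D_pos by (simp add: c_low_def)
    then have "D * (a x - c) - (\<mu> * a x - 2 * \<delta>) * \<mu> = 2 * \<gamma> * \<sigma>\<^sup>2 * a x"
      by (simp add: algebra_simps power2_eq_square)
    moreover have "\<mu> * (k * (a x - c) / a x) / (2 * \<gamma>) * slope_low x
        + (\<mu> * a x - 2 * \<delta>) / (2 * \<gamma>) * (- \<mu> / (\<sigma>\<^sup>2 * a x) * slope_low x)
        = (D * (a x - c) - (\<mu> * a x - 2 * \<delta>) * \<mu>) / (2 * \<gamma> * \<sigma>\<^sup>2 * a x) * slope_low x"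
      using mu sigma gamma a_pos[of x] by (simp add: divide_simps) (simp add: algebra_simps)
    ultimately show ?thesis using sigma gamma a_pos[of x] by simp
  qed
  ultimately show ?thesis by simp
qed

lemma V_high_DERIV:
  "((\<lambda>x. M / \<gamma> - \<sigma>\<^sup>2 * ct / \<mu> * slope_high x) has_real_derivative slope_high x) (at x)"
  using mu sigma ct_pos by (auto intro!: derivative_eq_intros slope_high_DERIV)

lemma V_eq: "V = (\<lambda>x. if x < x1 then (\<mu> * a x - 2 * \<delta>) / (2 * \<gamma>) * slope_low x
    else M / \<gamma> - \<sigma>\<^sup>2 * ct / \<mu> * slope_high x)"
  by (simp add: fun_eq_iff V_fun_def slope_low_def slope_high_def)

section \<open>The glued function\<close>

lemma V_DERIV: "(V has_real_derivative slope x) (at x)"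
proof -
  have "(\<mu> * ct - 2 * \<delta>) / (2 * \<gamma>) = M / \<gamma> - \<sigma>\<^sup>2 * ct / \<mu>"
  proof -
    have "(\<mu> * ct - 2 * \<delta>) / (2 * \<gamma>) = (\<mu> * ct / 2 - \<delta>) / \<gamma>"
      using gamma by (simp add: field_simps)
    also have "\<dots> = M / \<gamma> - \<sigma>\<^sup>2 * ct / \<mu>"
      unfolding ct_equation using gamma by (simp add: diff_divide_distrib)
    finally show ?thesis .
  qed
  then show ?thesis
    unfolding V_eq slope_def
    by (intro DERIV_glue V_low_DERIV V_high_DERIV) (simp_all add: a_x1 slope_low_x1 slope_high_x1)
qed

lemma curvature_eq: "curvature = (\<lambda>x. if x < x1 then - \<mu> / (\<sigma>\<^sup>2 * a x) * slope_low x
    else - \<mu> / (\<sigma>\<^sup>2 * ct) * slope_high x)"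
  by (simp add: fun_eq_iff curvature_def control_def slope_def)

lemma slope_DERIV: "(slope has_real_derivative curvature x) (at x)"
  unfolding slope_def[abs_def] curvature_eq
  by (intro DERIV_glue slope_low_DERIV slope_high_DERIV)
    (simp_all add: a_x1 slope_low_x1 slope_high_x1)

lemma curvature_continuous: "continuous_on UNIV curvature"
proof -
  have "continuous_on UNIV a" "continuous_on UNIV slope_low" "continuous_on UNIV slope_high"
    using a_DERIV slope_low_DERIV slope_high_DERIV
    by (meson DERIV_isCont continuous_at_imp_continuous_on)+
  then show ?thesis
    unfolding curvature_eq using sigma a_pos
    by (intro continuous_on_glue continuous_intros)
      (auto simp: a_x1 slope_low_x1 slope_high_x1 less_imp_neq[THEN not_sym])
qed

lemma control_pos: "control x > 0"
  using a_pos ct_pos by (simp add: control_def)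

lemma curvature_nonpos: "curvature x \<le> 0"
  using control_pos[of x] slope_pos[of x] mu sigma by (simp add: curvature_def)

lemma V_C2: "C2_derivs_on {0..} V slope curvature"
  using V_DERIV slope_DERIV curvature_continuous
  by (auto simp: C2_derivs_on_def intro: has_field_derivative_at_within continuous_on_subset)

lemma V_concave: "concave_on {0..} V"
  using V_DERIV slope_DERIV curvature_nonpos by (intro f''_le0_imp_concave) auto

lemma V_mono: "x \<le> y \<Longrightarrow> V x \<le> V y"
  using V_DERIV slope_pos by (meson DERIV_nonneg_imp_nondecreasing less_imp_le)

lemma V_zero: "V 0 = 0"
  using x1_pos mu by (simp add: V_eq a_zero)

lemma V_le: "V x \<le> M / \<gamma>"
proof -
  have "V (max x x1) \<le> M / \<gamma>"
    using mu ct_pos by (simp add: V_eq slope_high_def)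
  then show ?thesis using V_mono[of x "max x x1"] by simp
qed

section \<open>The HJB equation\<close>

lemma running_payoff:
  "M * max (1 - slope x) 0 - \<gamma> * V x = (\<delta> - \<mu> * control x / 2) * slope x"
proof (cases "x < x1")
  case True
  then show ?thesis
    using slope_ge_one[OF True] gamma by (simp add: V_eq slope_def control_def field_simps)
next
  case False
  then have "M * max (1 - slope x) 0 - \<gamma> * V x
      = M * (1 - slope x) - \<gamma> * (M / \<gamma> - \<sigma>\<^sup>2 * ct / \<mu> * slope x)"
    using slope_le_one[of x] by (simp add: V_eq slope_def)
  also have "\<dots> = - (M - \<gamma> * \<sigma>\<^sup>2 * ct / \<mu>) * slope x"
    using gamma by (simp add: algebra_simps)
  also have "\<dots> = (\<delta> - \<mu> * control x / 2) * slope x"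
    using False by (simp add: ct_equation[symmetric] control_def)
  finally show ?thesis .
qed

text \<open>Completing the square shows that \<open>control x\<close> is the maximizer.\<close>
lemma HJB_square:
  "1 / 2 * \<sigma>\<^sup>2 * s\<^sup>2 * curvature x + (s * \<mu> - \<delta>) * slope x - \<gamma> * V x + M * max (1 - slope x) 0
    = - (\<mu> * slope x / (2 * control x)) * (s - control x)\<^sup>2"
proof -
  have "1 / 2 * \<sigma>\<^sup>2 * s\<^sup>2 * curvature x = - (\<mu> * slope x / (2 * control x)) * s\<^sup>2"
    using sigma control_pos[of x] by (simp add: curvature_def field_simps)
  moreover have "- (\<mu> * slope x / (2 * control x)) * (s - control x)\<^sup>2
      = - (\<mu> * slope x / (2 * control x)) * s\<^sup>2 + \<mu> * slope x * s - \<mu> * slope x * control x / 2"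
    using control_pos[of x] by (simp add: field_simps power2_eq_square)
  ultimately show ?thesis
    using running_payoff[of x] by (simp add: algebra_simps)
qed

lemma control_bounds: "x \<ge> 0 \<Longrightarrow> 2 * \<delta> / \<mu> \<le> control x \<and> control x \<le> ct"
  using strict_mono_less_eq[OF a_strict_mono, of 0 x] strict_mono_less_eq[OF a_strict_mono, of x x1]
    start_less_ct by (auto simp: control_def a_zero a_x1)

lemma HJB:
  assumes "x \<ge> 0" and "\<alpha> \<le> 2 * \<delta> / \<mu>" and "ct \<le> \<beta>"
  shows "is_maximum_on
    (\<lambda>s. 1 / 2 * \<sigma>\<^sup>2 * s\<^sup>2 * curvature x + (s * \<mu> - \<delta>) * slope x
         - \<gamma> * V x + M * max (1 - slope x) 0) {\<alpha>..\<beta>} 0"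
  unfolding HJB_square is_maximum_on_def
proof (intro conjI ballI bexI[of _ "control x"])
  show "control x \<in> {\<alpha>..\<beta>}" using control_bounds assms by force
  show "- (\<mu> * slope x / (2 * control x)) * (s - control x)\<^sup>2 \<le> 0" for s
    using mu slope_pos[of x] control_pos[of x] by (auto intro!: divide_nonneg_nonneg mult_nonneg_nonneg)
qed simp

end

theorem theorem3p15:
  fixes \<mu> \<sigma> \<gamma> \<delta> M \<alpha> \<beta> :: real
  assumes "\<mu> > 0" and "\<sigma> > 0" and "\<gamma> > 0" and "\<delta> \<ge> 0" and "M > 0"
    and "0 < \<alpha>" and "\<alpha> < \<beta>"
    and "\<alpha> \<le> 2 * \<delta> / \<mu>" and "2 * \<delta> / \<mu> < \<beta>"
    and "M_zero \<mu> \<sigma> \<gamma> \<delta> (2 * \<delta> / \<mu>) < M" and "M \<le> M_beta \<mu> \<sigma> \<gamma> \<delta> \<beta>"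
  shows "concave_on {0..} (V_fun \<mu> \<sigma> \<gamma> \<delta> M)
    \<and> (\<exists>V' V''.
         C2_derivs_on {0..} (V_fun \<mu> \<sigma> \<gamma> \<delta> M) V' V'' \<and>
         (\<forall>x\<ge>0. is_maximum_on
           (\<lambda>a. 1 / 2 * \<sigma>\<^sup>2 * a\<^sup>2 * V'' x + (a * \<mu> - \<delta>) * V' x
                - \<gamma> * V_fun \<mu> \<sigma> \<gamma> \<delta> M x + M * max (1 - V' x) 0)
           {\<alpha>..\<beta>} 0))
    \<and> V_fun \<mu> \<sigma> \<gamma> \<delta> M 0 = 0
    \<and> (\<forall>x>0. 0 \<le> V_fun \<mu> \<sigma> \<gamma> \<delta> M x \<and> V_fun \<mu> \<sigma> \<gamma> \<delta> M x \<le> M / \<gamma>)"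
proof -
  have "\<delta> > 0"
    using assms(1,4,6,8) by (cases "\<delta> = 0") auto
  then interpret dividend_problem \<mu> \<sigma> \<gamma> \<delta> M
    using assms by unfold_locales auto
  have "c_tilde \<mu> \<sigma> \<gamma> \<delta> M - c = M / (D / (2 * \<mu>))"
    by (simp add: c_tilde_def c_low_def diff_divide_distrib[symmetric] right_diff_distrib[symmetric]
        distrib_left mult_ac)
  also have "\<dots> \<le> \<beta> - c"
    using assms(11) D_pos mu by (simp add: M_beta_def divide_simps mult_ac)
  finally have "c_tilde \<mu> \<sigma> \<gamma> \<delta> M \<le> \<beta>" by simp
  then have "\<forall>x\<ge>0. is_maximum_on
           (\<lambda>a. 1 / 2 * \<sigma>\<^sup>2 * a\<^sup>2 * curvature x + (a * \<mu> - \<delta>) * slope x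
                - \<gamma> * V_fun \<mu> \<sigma> \<gamma> \<delta> M x + M * max (1 - slope x) 0)
           {\<alpha>..\<beta>} 0"
    using HJB assms(8) by blast
  moreover have "0 \<le> V x \<and> V x \<le> M / \<gamma>" if "x > 0" for x
    using V_mono[of 0 x] V_zero V_le that by simp
  ultimately show ?thesis
    using V_concave V_C2 V_zero by blast
qed

end
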